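(* For every infinite sequence $w\in\{L,R\}^{\mathbb{N}}$ and every integer $n\ge 0$, $\mu_{w(n)}=\mu_1\ast P_{w(n)}$, where $P_{w(n)}=\Phi_{w(n)}(\delta_0)$. Explicitly, $$\mu_{w(n)}(d)=\sum_{k\le 1}\left(\tfrac12\right)^{2-k}P_{w(n)}(d-k),\qquad d\in\mathbb{Z},$$ where the sum is over all integers $k\le 1$.
   Context: $\mathbb{N}=\{0,1,2,\dots\}$. For $n\in\mathbb{N}$, $s(n)$ is the number of ones in the binary expansion of $n$. For $t\in\mathbb{N}$, $d\in\mathbb{Z}$, $\mu_t(d)=\lim_{N\to\infty}\frac1N|\{n<N: s(n+t)-s(n)=d\}|$. It is well known that the limit exists and $\mu_t$ is a probability measure on $\mathbb{Z}$ with mean zero. $\Delta_0(\mathbb{Z})$ is the set of probability measures on $\mathbb{Z}$ with finite first absolute moment and mean $0$; $\delta_k$ is the point mass at $k$; $(\mu\ast\nu)(d)=\sum_{k\in\mathbb{Z}}\mu(k)\nu(d-k)$. The shift $\sigma_d$ is $(\sigma_dP)(k)=P(k-d)$; $\sigma_L:=\sigma_{-1}$, $\sigma_R:=\sigma_1$. Define $\Phi(\mu,\nu)=\frac12\sigma_L(\mu)+\frac12\sigma_R(\nu)$, $\Phi_L(\mu,\nu)=(\Phi(\mu,\nu),\nu)$, $\Phi_R(\mu,\nu)=(\mu,\Phi(\mu,\nu))$ for $\mu,\nu\in\Delta_0(\mathbb{Z})$. On odd positive integers let $L(t)=2t-1$, $R(t)=2t+1$. For $w=(w_1,w_2,\dots)\in\{L,R\}^{\mathbb{N}}$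 set $w(0)=3$ and $w(n)=w_n\circ\cdots\circ w_1(3)$ for $n\ge1$. The map $\Phi_{w(n)}:\Delta_0(\mathbb{Z})\to\Delta_0(\mathbb{Z})$ is $\Phi_{w(0)}(\mu)=\Phi(\mu,\mu)$ and $\Phi_{w(n)}(\mu)=\Phi\circ\Phi_{w_n}\circ\cdots\circ\Phi_{w_1}(\mu,\mu)$ for $n\ge 1$. *)

theory Defs
  imports "HOL-Analysis.Analysis"
begin

definition s :: "nat \<Rightarrow> nat" where
  "s n = card {i. bit n i}"

text \<open>A measure on the integers is represented by its point masses, a function
  \<^typ>\<open>int \<Rightarrow> real\<close>.\<close>

definition \<mu> :: "nat \<Rightarrow> int \<Rightarrow> real" where
  "\<mu> t d = lim (\<lambda>N. real (card {n. n < N \<and> int (s (n + t)) - int (s n) = d}) / real N)"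

definition Delta0 :: "(int \<Rightarrow> real) set" where
  "Delta0 = {P. (\<forall>k. 0 \<le> P k) \<and> (P has_sum 1) UNIV
     \<and> (\<lambda>k. \<bar>real_of_int k\<bar> * P k) summable_on UNIV
     \<and> ((\<lambda>k. real_of_int k * P k) has_sum 0) UNIV}"

definition point_mass :: "int \<Rightarrow> int \<Rightarrow> real" where
  "point_mass k d = (if d = k then 1 else 0)"

definition conv :: "(int \<Rightarrow> real) \<Rightarrow> (int \<Rightarrow> real) \<Rightarrow> int \<Rightarrow> real"  (infixl "\<star>" 70) where
  "(P \<star> Q) d = (\<Sum>\<^sub>\<infinity>k\<in>UNIV. P k * Q (d - k))"

definition shift :: "int \<Rightarrow> (int \<Rightarrow> real) \<Rightarrow> int \<Rightarrow> real" where
  "shift d P k = P (k - d)"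

abbreviation shift_L :: "(int \<Rightarrow> real) \<Rightarrow> int \<Rightarrow> real" where
  "shift_L \<equiv> shift (-1)"

abbreviation shift_R :: "(int \<Rightarrow> real) \<Rightarrow> int \<Rightarrow> real" where
  "shift_R \<equiv> shift 1"

definition \<Phi> :: "(int \<Rightarrow> real) \<times> (int \<Rightarrow> real) \<Rightarrow> int \<Rightarrow> real" where
  "\<Phi> = (\<lambda>(P, Q) k. 1/2 * shift_L P k + 1/2 * shift_R Q k)"

datatype letter = L | R

fun letter_map :: "letter \<Rightarrow> nat \<Rightarrow> nat" where
  "letter_map L t = 2 * t - 1"
| "letter_map R t = 2 * t + 1"

fun \<Phi>_letter ::
  "letter \<Rightarrow> (int \<Rightarrow> real) \<times> (int \<Rightarrow> real) \<Rightarrow> (int \<Rightarrow> real) \<times> (int \<Rightarrow> real)" where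
  "\<Phi>_letter L (P, Q) = (\<Phi> (P, Q), Q)"
| "\<Phi>_letter R (P, Q) = (P, \<Phi> (P, Q))"

text \<open>An infinite word $(w_1, w_2, \ldots)$ is a function on the naturals starting at index 0,
  so the letter $w_{i+1}$ is \<open>w i\<close>.\<close>

primrec word_nat :: "(nat \<Rightarrow> letter) \<Rightarrow> nat \<Rightarrow> nat" where
  "word_nat w 0 = 3"
| "word_nat w (Suc n) = letter_map (w n) (word_nat w n)"

primrec \<Phi>_letters :: "(nat \<Rightarrow> letter) \<Rightarrow> nat
    \<Rightarrow> (int \<Rightarrow> real) \<times> (int \<Rightarrow> real) \<Rightarrow> (int \<Rightarrow> real) \<times> (int \<Rightarrow> real)" where
  "\<Phi>_letters w 0 PQ = PQ"
| "\<Phi>_letters w (Suc n) PQ = \<Phi>_letter (w n) (\<Phi>_letters w n PQ)"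

definition \<Phi>_word :: "(nat \<Rightarrow> letter) \<Rightarrow> nat \<Rightarrow> (int \<Rightarrow> real) \<Rightarrow> int \<Rightarrow> real" where
  "\<Phi>_word w n P = \<Phi> (\<Phi>_letters w n (P, P))"

definition P_word :: "(nat \<Rightarrow> letter) \<Rightarrow> nat \<Rightarrow> int \<Rightarrow> real" where
  "P_word w n = \<Phi>_word w n (point_mass 0)"

text \<open>The maps above are defined on all functions; the following facts say that they restrict
  to \<^const>\<open>Delta0\<close>.\<close>

lemma point_mass_0_in_Delta0: "point_mass 0 \<in> Delta0"
proof -
  have 1: "(point_mass 0 has_sum 1) UNIV"
    using has_sum_finite_neutralI[of "{0::int}" UNIV "point_mass 0" 1]
    by (simp add: point_mass_def)
  have z: "(\<lambda>k. \<bar>real_of_int k\<bar> * point_mass 0 k) = (\<lambda>_. 0)"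
    "(\<lambda>k. real_of_int k * point_mass 0 k) = (\<lambda>_. 0)"
    by (auto simp: point_mass_def)
  show ?thesis unfolding Delta0_def mem_Collect_eq z
    using 1 by (auto simp: point_mass_def)
qed

lemma has_sum_shift:
  fixes f :: "int \<Rightarrow> real"
  assumes "(f has_sum a) UNIV"
  shows "((\<lambda>k. f (k - d)) has_sum a) UNIV"
proof -
  have "bij_betw (\<lambda>k::int. k - d) UNIV UNIV"
    by (rule bij_betwI[where g = "\<lambda>k. k + d"]) auto
  from has_sum_reindex_bij_betw[OF this, of f a] assms show ?thesis by simp
qed

lemma shift_moments:
  assumes "P \<in> Delta0"
  shows "(shift d P has_sum 1) UNIV"
    and "((\<lambda>k. real_of_int k * shift d P k) has_sum d) UNIV"
    and "(\<lambda>k. \<bar>real_of_int k\<bar> * shift d P k) summable_on UNIV"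
proof -
  have P: "\<And>k. 0 \<le> P k" "(P has_sum 1) UNIV"
    "(\<lambda>k. \<bar>real_of_int k\<bar> * P k) summable_on UNIV"
    "((\<lambda>k. real_of_int k * P k) has_sum 0) UNIV"
    using assms by (auto simp: Delta0_def)
  show "(shift d P has_sum 1) UNIV"
    using has_sum_shift[OF P(2), of d] by (simp add: shift_def[abs_def])
  have "((\<lambda>k. real_of_int k * P k + real_of_int d * P k) has_sum (0 + real_of_int d * 1)) UNIV"
    by (intro has_sum_add P(4) has_sum_cmult_right P(2))
  from has_sum_shift[OF this, of d]
  show "((\<lambda>k. real_of_int k * shift d P k) has_sum d) UNIV"
    by (simp add: shift_def algebra_simps)
  have "(\<lambda>k. \<bar>real_of_int k\<bar> * P k + \<bar>real_of_int d\<bar> * P k) summable_on UNIV"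
    using P(2) by (intro summable_on_add P(3) summable_on_cmult_right) (auto simp: summable_on_def)
  then obtain a where
    "((\<lambda>k. \<bar>real_of_int k\<bar> * P k + \<bar>real_of_int d\<bar> * P k) has_sum a) UNIV"
    by (auto simp: summable_on_def)
  from has_sum_shift[OF this, of d]
  have "(\<lambda>k. \<bar>real_of_int (k - d)\<bar> * P (k - d) + \<bar>real_of_int d\<bar> * P (k - d)) summable_on UNIV"
    by (auto simp: summable_on_def)
  then show "(\<lambda>k. \<bar>real_of_int k\<bar> * shift d P k) summable_on UNIV"
  proof (rule summable_on_comparison_test)
    fix k
    have "\<bar>real_of_int k\<bar> * P (k - d) \<le> (\<bar>real_of_int (k - d)\<bar> + \<bar>real_of_int d\<bar>) * P (k - d)"
      by (intro mult_right_mono P(1)) auto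
    then show "\<bar>real_of_int k\<bar> * shift d P k
        \<le> \<bar>real_of_int (k - d)\<bar> * P (k - d) + \<bar>real_of_int d\<bar> * P (k - d)"
      by (simp add: shift_def algebra_simps)
    show "0 \<le> \<bar>real_of_int k\<bar> * shift d P k"
      using P(1) by (simp add: shift_def)
  qed
qed

lemma \<Phi>_in_Delta0:
  assumes P: "P \<in> Delta0" and Q: "Q \<in> Delta0"
  shows "\<Phi> (P, Q) \<in> Delta0"
proof -
  note p = shift_moments[OF P, of "-1"] and q = shift_moments[OF Q, of 1]
  have nn: "0 \<le> \<Phi> (P, Q) k" for k
    using P Q by (auto simp: Delta0_def \<Phi>_def shift_def)
  have 1: "(\<Phi> (P, Q) has_sum 1) UNIV"
    using has_sum_add[OF has_sum_cmult_right[OF p(1), of "1/2"] has_sum_cmult_right[OF q(1), of "1/2"]]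
    by (simp add: \<Phi>_def)
  have 2: "((\<lambda>k. real_of_int k * \<Phi> (P, Q) k) has_sum 0) UNIV"
    using has_sum_add[OF has_sum_cmult_right[OF p(2), of "1/2"] has_sum_cmult_right[OF q(2), of "1/2"]]
    by (simp add: \<Phi>_def algebra_simps)
  have 3: "(\<lambda>k. \<bar>real_of_int k\<bar> * \<Phi> (P, Q) k) summable_on UNIV"
    using summable_on_add[OF summable_on_cmult_right[OF p(3), of "1/2"]
        summable_on_cmult_right[OF q(3), of "1/2"]]
    by (simp add: \<Phi>_def algebra_simps)
  show ?thesis using nn 1 2 3 by (simp add: Delta0_def)
qed

lemma \<Phi>_letters_in_Delta0:
  assumes "P \<in> Delta0"
  shows "\<Phi>_letters w n (P, P) \<in> Delta0 \<times> Delta0"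
proof (induction n)
  case (Suc n)
  then show ?case
    by (cases "w n"; cases "\<Phi>_letters w n (P, P)") (auto intro: \<Phi>_in_Delta0)
qed (use assms in simp)

lemma \<Phi>_word_in_Delta0: "P \<in> Delta0 \<Longrightarrow> \<Phi>_word w n P \<in> Delta0"
  using \<Phi>_letters_in_Delta0[of P w n]
  by (cases "\<Phi>_letters w n (P, P)") (auto simp: \<Phi>_word_def intro: \<Phi>_in_Delta0)

end

theory Submission
  imports Defs
begin

text \<open>Splitting the integers \<open>n\<close> by parity gives \<open>\<mu> (2 * t) = \<mu> t\<close> and
  \<open>\<mu> (2 * t + 1) = \<Phi> (\<mu> (t + 1), \<mu> t)\<close>. If \<open>w(n) = 2 * m + 1\<close>, then the letter maps act on the
  pair \<open>(\<mu> (m + 1), \<mu> m)\<close> exactly as \<open>\<Phi>\<^sub>L\<close> and \<open>\<Phi>\<^sub>R\<close> do, starting from \<open>(\<mu> 2, \<mu> 1) = (\<mu> 1, \<mu> 1)\<close>.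
  Since \<open>\<Phi>\<close> is linear and commutes with shifts, it commutes with convolution by \<open>\<mu> 1\<close>, so
  the start \<open>(\<mu> 1, \<mu> 1)\<close> may be replaced by the point mass at 0.\<close>

section \<open>Natural density under splitting by parity\<close>

text \<open>\<open>\<mu>\<close> is defined by \<open>lim\<close>, which is informative only under
  convergence; this relation carries convergence together with the value.\<close>

definition has_density :: "nat set \<Rightarrow> real \<Rightarrow> bool" where
  "has_density A a \<longleftrightarrow> (\<lambda>N. real (card {n. n < N \<and> n \<in> A}) / real N) \<longlonglongrightarrow> a"

lemma has_density_empty: "has_density {} 0"
  by (simp add: has_density_def)

lemma has_density_UNIV: "has_density UNIV 1"
proof -
  have "\<forall>\<^sub>F N in sequentially. real (card {n. n < N \<and> n \<in> (UNIV::nat set)}) / real N = 1"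
    using eventually_gt_at_top[of 0] by eventually_elim simp
  then show ?thesis
    unfolding has_density_def by (rule tendsto_eventually)
qed

lemma card_parity_split:
  fixes A :: "nat set"
  shows "card {n. n < N \<and> n \<in> A}
    = card {n. n < (N + 1) div 2 \<and> 2 * n \<in> A} + card {n. n < N div 2 \<and> 2 * n + 1 \<in> A}"
proof -
  let ?E = "{n. n < (N + 1) div 2 \<and> 2 * n \<in> A}" and ?O = "{n. n < N div 2 \<and> 2 * n + 1 \<in> A}"
  have "n \<in> (\<lambda>n. 2 * n) ` ?E \<union> (\<lambda>n. 2 * n + 1) ` ?O" if "n < N" "n \<in> A" for n
  proof (cases "even n")
    case True
    then obtain m where "n = 2 * m" by blast
    with that show ?thesis by auto
  next
    case False
    then obtain m where "n = 2 * m + 1" by (elim oddE)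
    with that show ?thesis by auto
  qed
  then have "{n. n < N \<and> n \<in> A} = (\<lambda>n. 2 * n) ` ?E \<union> (\<lambda>n. 2 * n + 1) ` ?O"
    by auto
  moreover have "(\<lambda>n. 2 * n) ` ?E \<inter> (\<lambda>n. 2 * n + 1) ` ?O = {}"
    by auto presburger
  ultimately have "card {n. n < N \<and> n \<in> A}
    = card ((\<lambda>n. 2 * n) ` ?E) + card ((\<lambda>n. 2 * n + 1) ` ?O)"
    by (simp add: card_Un_disjoint)
  also have "\<dots> = card ?E + card ?O"
    by (simp add: card_image inj_on_def)
  finally show ?thesis .
qed

text \<open>For each parity class, count / \<open>N\<close> factors as (half-length /
  \<open>N\<close>) * (count / half-length), and the first factor tends to 1/2.\<close>

lemma has_density_parity:
  assumes "has_density {n. 2 * n \<in> A} a" "has_density {n. 2 * n + 1 \<in> A} b"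
  shows "has_density A (1/2 * a + 1/2 * b)"
proof -
  define E where "E M = real (card {n. n < M \<and> 2 * n \<in> A})" for M
  define F where "F M = real (card {n. n < M \<and> 2 * n + 1 \<in> A})" for M
  have E: "(\<lambda>M. E M / real M) \<longlonglongrightarrow> a" and F: "(\<lambda>M. F M / real M) \<longlonglongrightarrow> b"
    using assms by (simp_all add: has_density_def E_def F_def)
  \<comment> \<open>One bound serves both half-lengths: \<open>c = 1\<close> belongs to the even
    numbers below \<open>N\<close>, \<open>c = 0\<close> to the odd ones.\<close>
  have half: "(\<lambda>N::nat. real ((N + c) div 2) / real N) \<longlonglongrightarrow> 1/2" if "c \<le> 1" for c
  proof (rule tendsto_sandwich)
    have *: "2 * ((N + c) div 2) \<le> N + 1 \<and> N \<le> 2 * ((N + c) div 2) + 1" for N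
      using that by presburger
    have **: "2 * real ((N + c) div 2) \<le> N + 1 \<and> N \<le> 2 * real ((N + c) div 2) + 1" for N
      using *[of N] by linarith
    show "\<forall>\<^sub>F N in sequentially. 1/2 - 1/2 / real N \<le> real ((N + c) div 2) / real N"
      using eventually_gt_at_top[of 0]
    proof eventually_elim
      case (elim N)
      then have "1/2 - 1/2 / real N = (real N - 1) / 2 / real N"
        by (simp add: field_simps)
      also have "\<dots> \<le> real ((N + c) div 2) / real N"
        using **[of N] by (intro divide_right_mono) simp_all
      finally show ?case .
    qed
    show "\<forall>\<^sub>F N in sequentially. real ((N + c) div 2) / real N \<le> 1/2 + 1/2 / real N"
      using eventually_gt_at_top[of 0]
    proof eventually_elim
      case (elim N)
      have "real ((N + c) div 2) / real N \<le> (real N + 1) / 2 / real N"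
        using **[of N] by (intro divide_right_mono) simp_all
      also have "\<dots> = 1/2 + 1/2 / real N"
        using elim by (simp add: field_simps)
      finally show ?case .
    qed
    show "(\<lambda>N. 1/2 - 1/2 / real N) \<longlonglongrightarrow> 1/2" "(\<lambda>N. 1/2 + 1/2 / real N) \<longlonglongrightarrow> 1/2"
      using tendsto_diff[OF tendsto_const lim_const_over_n, of "1/2" "1/2"]
        tendsto_add[OF tendsto_const lim_const_over_n, of "1/2" "1/2"] by simp_all
  qed
  have lim: "filterlim (\<lambda>N::nat. (N + c) div 2) at_top sequentially" for c
    unfolding filterlim_at_top
    by (metis (mono_tags, lifting) div_le_mono eventually_at_top_linorderI
        nonzero_mult_div_cancel_left trans_le_add1 zero_neq_numeral)
  have "(\<lambda>N. real ((N + 1) div 2) / real N * (E ((N + 1) div 2) / real ((N + 1) div 2))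
      + real ((N + 0) div 2) / real N * (F ((N + 0) div 2) / real ((N + 0) div 2)))
    \<longlonglongrightarrow> 1/2 * a + 1/2 * b"
    by (intro tendsto_add tendsto_mult half filterlim_compose[OF E lim] filterlim_compose[OF F lim])
      simp_all
  also have "(\<lambda>N. real ((N + 1) div 2) / real N * (E ((N + 1) div 2) / real ((N + 1) div 2))
      + real ((N + 0) div 2) / real N * (F ((N + 0) div 2) / real ((N + 0) div 2)))
    = (\<lambda>N. E ((N + 1) div 2) / real N + F (N div 2) / real N)"
  proof
    fix N
    \<comment> \<open>A half-length 0 cannot be cancelled; both sides then agree because the count
      is 0 as well.\<close>
    have "E 0 = 0" "F 0 = 0" by (simp_all add: E_def F_def)
    then show "real ((N + 1) div 2) / real N * (E ((N + 1) div 2) / real ((N + 1) div 2))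
      + real ((N + 0) div 2) / real N * (F ((N + 0) div 2) / real ((N + 0) div 2))
      = E ((N + 1) div 2) / real N + F (N div 2) / real N"
      by (cases "(N + 1) div 2 = 0"; cases "N div 2 = 0") simp_all
  qed
  finally show ?thesis
    by (simp add: has_density_def card_parity_split[of _ A] E_def F_def add_divide_distrib)
qed

section \<open>Binary digit sums and their increments\<close>

lemma s_double: "s (2 * n) = s n"
proof -
  have "{i. bit (2 * n) i} = Suc ` {i. bit n i}"
  proof (rule set_eqI)
    fix i show "i \<in> {i. bit (2 * n) i} \<longleftrightarrow> i \<in> Suc ` {i. bit n i}"
      by (cases i) (auto simp: bit_0 bit_Suc)
  qed
  then show ?thesis by (simp add: s_def card_image)
qed

lemma s_double_Suc: "s (2 * n + 1) = s n + 1"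
proof -
  have "{i. bit (2 * n + 1) i} = insert 0 (Suc ` {i. bit n i})"
  proof (rule set_eqI)
    fix i show "i \<in> {i. bit (2 * n + 1) i} \<longleftrightarrow> i \<in> insert 0 (Suc ` {i. bit n i})"
      by (cases i) (auto simp: bit_0 bit_Suc)
  qed
  moreover have "finite {i. bit n i}"
  proof (rule finite_subset)
    \<comment> \<open>A set bit \<open>i\<close> forces \<open>2 ^ i \<le> n\<close>, hence
      \<open>i < n\<close>.\<close>
    show "{i. bit n i} \<subseteq> {..n}"
      by (auto simp: bit_iff_odd)
        (metis div_less even_zero less_exp nat_le_linear not_le order.strict_trans)
  qed simp
  ultimately show ?thesis by (simp add: s_def card_image)
qed

definition diff_set :: "nat \<Rightarrow> int \<Rightarrow> nat set" where
  "diff_set t d = {n. int (s (n + t)) - int (s n) = d}"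

text \<open>Adding \<open>2 * t + 1\<close> to an even number turns the last digit into a one
  without a carry; for an odd number the last one is lost and the carry turns \<open>t\<close> into
  \<open>t + 1\<close>.\<close>

lemma diff_set_parity:
  "{n. 2 * n \<in> diff_set (2 * t) d} = diff_set t d"
  "{n. 2 * n + 1 \<in> diff_set (2 * t) d} = diff_set t d"
  "{n. 2 * n \<in> diff_set (2 * t + 1) d} = diff_set t (d - 1)"
  "{n. 2 * n + 1 \<in> diff_set (2 * t + 1) d} = diff_set (t + 1) (d + 1)"
proof -
  have "s (2 * n + 2 * t) = s (n + t)" "s (2 * n + 1 + 2 * t) = s (n + t) + 1"
    "s (2 * n + (2 * t + 1)) = s (n + t) + 1" "s (2 * n + 1 + (2 * t + 1)) = s (n + (t + 1))" for n
    using s_double[of "n + t"] s_double_Suc[of "n + t"] s_double[of "n + (t + 1)"]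
    by (simp_all add: algebra_simps)
  then show "{n. 2 * n \<in> diff_set (2 * t) d} = diff_set t d"
    "{n. 2 * n + 1 \<in> diff_set (2 * t) d} = diff_set t d"
    "{n. 2 * n \<in> diff_set (2 * t + 1) d} = diff_set t (d - 1)"
    "{n. 2 * n + 1 \<in> diff_set (2 * t + 1) d} = diff_set (t + 1) (d + 1)"
    unfolding diff_set_def mem_Collect_eq s_double s_double_Suc by auto
qed

lemma diff_set_0: "diff_set 0 d = (if d = 0 then UNIV else {})"
  by (auto simp: diff_set_def)

lemma has_density_double:
  "has_density (diff_set t d) a \<Longrightarrow> has_density (diff_set (2 * t) d) a"
  using has_density_parity[of "diff_set (2 * t) d" a a] by (simp add: diff_set_parity[simplified])

lemma has_density_double_Suc:
  assumes "has_density (diff_set t (d - 1)) a" "has_density (diff_set (t + 1) (d + 1)) b"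
  shows "has_density (diff_set (2 * t + 1) d) (1/2 * a + 1/2 * b)"
  using assms by (intro has_density_parity) (simp_all only: diff_set_parity)

lemma s_Suc_le: "s (Suc n) \<le> Suc (s n)"
proof (induction n rule: less_induct)
  case (less n)
  show ?case
  proof (cases "even n")
    case True
    then obtain m where "n = 2 * m" by blast
    then show ?thesis using s_double[of m] s_double_Suc[of m] by simp
  next
    case False
    then obtain m where m: "n = 2 * m + 1" by (elim oddE)
    then show ?thesis using s_double[of "Suc m"] s_double_Suc[of m] less.IH[of m] by simp
  qed
qed

text \<open>The recursion at \<open>1 = 2 * 0 + 1\<close> leads back to 1 itself, but with
  \<open>d + 1\<close> for \<open>d\<close>. Hence the induction goes downward from
  \<open>d = 1\<close>, above which \<open>s_Suc_le\<close> leaves only empty sets.\<close>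

lemma has_density_diff_set_1:
  "has_density (diff_set 1 d) (if d \<le> 1 then (1/2) powi (2 - d) else 0)"
proof (cases "d \<le> 1")
  case False
  have "int (s (n + 1)) - int (s n) \<noteq> d" for n
    using s_Suc_le[of n] False by simp
  then have "diff_set 1 d = {}"
    by (simp add: diff_set_def)
  then show ?thesis using False has_density_empty by simp
next
  case True
  then show ?thesis
  proof (induction d rule: int_le_induct)
    case base
    have "diff_set 1 2 = {}"
    proof -
      have "int (s (n + 1)) - int (s n) \<noteq> 2" for n
        using s_Suc_le[of n] by simp
      then show ?thesis by (simp add: diff_set_def)
    qed
    then have "has_density (diff_set (2 * 0 + 1) 1) (1/2 * 1 + 1/2 * 0)"
      by (intro has_density_double_Suc)
        (simp_all add: diff_set_0 has_density_UNIV has_density_empty)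
    then show ?case by simp
  next
    case (step d)
    \<comment> \<open>As \<open>d \<le> 1\<close>, the value \<open>d - 2\<close> is nonzero, so the
      even numbers contribute nothing.\<close>
    then have "has_density (diff_set (2 * 0 + 1) (d - 1)) (1/2 * 0 + 1/2 * ((1/2) powi (2 - d)))"
      by (intro has_density_double_Suc) (simp_all add: diff_set_0 has_density_empty)
    moreover have "(1/2::real) powi (2 - (d - 1)) = 1/2 * ((1/2) powi (2 - d))"
      using power_int_add[of "1/2::real" 1 "2 - d"] by (simp add: algebra_simps)
    ultimately have "has_density (diff_set 1 (d - 1)) ((1/2) powi (2 - (d - 1)))"
      by (simp only: mult_zero_right add_0)
    then show ?case using step.hyps by simp
  qed
qed

section \<open>Existence of the limits and the recursion for \<open>\<mu>\<close>\<close>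

lemma has_density_imp_\<mu>: "has_density (diff_set t d) a \<Longrightarrow> \<mu> t d = a"
  unfolding has_density_def \<mu>_def diff_set_def by (intro limI) simp

lemma has_density_\<mu>: "has_density (diff_set t d) (\<mu> t d)"
proof -
  have "\<exists>a. has_density (diff_set t d) a"
  proof (induction t arbitrary: d rule: less_induct)
    case (less t)
    \<comment> \<open>The values 0 and 1 stand apart because \<open>0 = 2 * 0\<close> and
      \<open>1 = 2 * 0 + 1\<close> would call the recursion at 0 and 1 again.\<close>
    consider "t = 0" | "t = 1" | m where "t = 2 * m" "m < t" | m where "t = 2 * m + 1" "m + 1 < t"
    proof (cases "even t")
      case True
      then obtain m where "t = 2 * m" by blast
      then show ?thesis using that(1) that(3)[of m] by fastforce
    next
      case False
      then obtain m where "t = 2 * m + 1" by (elim oddE)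
      then show ?thesis using that(2) that(4)[of m] by fastforce
    qed
    then show ?case
    proof cases
      case 1
      then show ?thesis using has_density_UNIV has_density_empty by (auto simp: diff_set_0)
    next
      case 2
      then show ?thesis using has_density_diff_set_1 by blast
    next
      case 3
      then show ?thesis using less.IH has_density_double by blast
    next
      case 4
      then have "m < t" by simp
      with 4 show ?thesis using less.IH has_density_double_Suc by metis
    qed
  qed
  then show ?thesis using has_density_imp_\<mu> by blast
qed

lemma \<mu>_1: "\<mu> 1 d = (if d \<le> 1 then (1/2) powi (2 - d) else 0)"
  by (rule has_density_imp_\<mu>[OF has_density_diff_set_1])

lemma \<mu>_double: "\<mu> (2 * t) = \<mu> t"
  by (rule ext) (intro has_density_imp_\<mu> has_density_double has_density_\<mu>)

lemma \<mu>_double_Suc: "\<mu> (2 * t + 1) = \<Phi> (\<mu> (t + 1), \<mu> t)"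
proof
  fix d
  have "\<mu> (2 * t + 1) d = 1/2 * \<mu> t (d - 1) + 1/2 * \<mu> (t + 1) (d + 1)"
    by (intro has_density_imp_\<mu> has_density_double_Suc has_density_\<mu>)
  then show "\<mu> (2 * t + 1) d = \<Phi> (\<mu> (t + 1), \<mu> t) d"
    by (simp add: \<Phi>_def shift_def)
qed

section \<open>Convolution by \<open>\<mu> 1\<close> along a word\<close>

text \<open>Stated with \<open>has_sum\<close>, since \<open>infsum\<close> defaults to 0 without
  summability; linearity then needs no separate convergence proofs.\<close>

definition is_conv :: "(int \<Rightarrow> real) \<Rightarrow> (int \<Rightarrow> real) \<Rightarrow> (int \<Rightarrow> real) \<Rightarrow> bool" where
  "is_conv M P Q \<longleftrightarrow> (\<forall>d. ((\<lambda>k. M k * P (d - k)) has_sum Q d) UNIV)"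

lemma is_conv_point_mass_0: "is_conv M (point_mass 0) M"
  unfolding is_conv_def
proof
  fix d
  show "((\<lambda>k. M k * point_mass 0 (d - k)) has_sum M d) UNIV"
    by (rule has_sum_finite_neutralI[of "{d}"]) (auto simp: point_mass_def)
qed

text \<open>Termwise, the two shifts move into the evaluation point, so the sums at
  \<open>d + 1\<close> and \<open>d - 1\<close> are averaged.\<close>

lemma is_conv_\<Phi>:
  assumes "is_conv M P P'" "is_conv M Q Q'"
  shows "is_conv M (\<Phi> (P, Q)) (\<Phi> (P', Q'))"
  unfolding is_conv_def
proof
  fix d
  have "((\<lambda>k. 1/2 * (M k * P (d + 1 - k)) + 1/2 * (M k * Q (d - 1 - k)))
      has_sum (1/2 * P' (d + 1) + 1/2 * Q' (d - 1))) UNIV"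
    using assms by (intro has_sum_add has_sum_cmult_right) (simp_all add: is_conv_def)
  then show "((\<lambda>k. M k * \<Phi> (P, Q) (d - k)) has_sum \<Phi> (P', Q') d) UNIV"
    by (simp add: \<Phi>_def shift_def algebra_simps)
qed

lemma is_conv_imp_conv: "is_conv M P Q \<Longrightarrow> Q = M \<star> P"
  by (rule ext) (auto simp: conv_def is_conv_def intro!: infsumI[symmetric])

lemma \<Phi>_letters_is_conv:
  "\<exists>m. word_nat w n = 2 * m + 1
    \<and> is_conv (\<mu> 1) (fst (\<Phi>_letters w n (point_mass 0, point_mass 0))) (\<mu> (m + 1))
    \<and> is_conv (\<mu> 1) (snd (\<Phi>_letters w n (point_mass 0, point_mass 0))) (\<mu> m)"
proof (induction n)
  case 0
  \<comment> \<open>Here \<open>3 = 2 * 1 + 1\<close>, and \<open>\<mu> 2 = \<mu> 1\<close>.\<close>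
  show ?case
    using is_conv_point_mass_0[of "\<mu> 1"] \<mu>_double[of 1]
    by (intro exI[of _ 1]) (simp add: numeral_2_eq_2)
next
  case (Suc n)
  obtain P Q where PQ: "\<Phi>_letters w n (point_mass 0, point_mass 0) = (P, Q)"
    by fastforce
  with Suc obtain m where m: "word_nat w n = 2 * m + 1"
    and P: "is_conv (\<mu> 1) P (\<mu> (m + 1))" and Q: "is_conv (\<mu> 1) Q (\<mu> m)"
    by auto
  have PhiPQ: "is_conv (\<mu> 1) (\<Phi> (P, Q)) (\<mu> (2 * m + 1))"
    unfolding \<mu>_double_Suc by (rule is_conv_\<Phi>[OF P Q])
  show ?case
  proof (cases "w n")
    case L
    \<comment> \<open>\<open>2 * (2 * m + 1) - 1 = 2 * (2 * m) + 1\<close>; the second entry stays,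
      as \<open>\<mu> (2 * m) = \<mu> m\<close>.\<close>
    then show ?thesis
      using PhiPQ Q m PQ \<mu>_double[of m] by (intro exI[of _ "2 * m"]) simp
  next
    case R
    \<comment> \<open>\<open>2 * (2 * m + 1) + 1\<close> has the new half \<open>2 * m + 1\<close>;
      the first entry stays, as \<open>\<mu> (2 * m + 2) = \<mu> (m + 1)\<close>.\<close>
    then show ?thesis
      using PhiPQ P m PQ \<mu>_double[of "m + 1"] by (intro exI[of _ "2 * m + 1"]) simp
  qed
qed

text \<open>The outer \<open>\<Phi>\<close> of \<open>\<Phi>_word\<close> merges the pair for
  \<open>m + 1\<close> and \<open>m\<close> into \<open>2 * m + 1\<close>.\<close>

lemma \<mu>_word_is_conv: "is_conv (\<mu> 1) (P_word w n) (\<mu> (word_nat w n))"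
proof -
  obtain m where "word_nat w n = 2 * m + 1"
    and "is_conv (\<mu> 1) (fst (\<Phi>_letters w n (point_mass 0, point_mass 0))) (\<mu> (m + 1))"
    and "is_conv (\<mu> 1) (snd (\<Phi>_letters w n (point_mass 0, point_mass 0))) (\<mu> m)"
    using \<Phi>_letters_is_conv by blast
  then show ?thesis
    using is_conv_\<Phi> by (fastforce simp: P_word_def \<Phi>_word_def \<mu>_double_Suc[simplified])
qed

theorem corollary7:
  fixes w :: "nat \<Rightarrow> letter" and n :: nat
  shows "\<mu> (word_nat w n) = \<mu> 1 \<star> P_word w n
    \<and> (\<forall>d::int. ((\<lambda>k::int. (1/2) powi (2 - k) * P_word w n (d - k))
          has_sum \<mu> (word_nat w n) d) {..1})"
proof (intro conjI allI)
  show "\<mu> (word_nat w n) = \<mu> 1 \<star> P_word w n"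
    by (rule is_conv_imp_conv[OF \<mu>_word_is_conv])
next
  fix d
  have "((\<lambda>k. \<mu> 1 k * P_word w n (d - k)) has_sum \<mu> (word_nat w n) d) UNIV"
    using \<mu>_word_is_conv by (simp add: is_conv_def)
  \<comment> \<open>\<open>\<mu> 1\<close> vanishes above 1, so restricting the index set drops only
    zero terms.\<close>
  also have "?this \<longleftrightarrow> ((\<lambda>k::int. (1/2) powi (2 - k) * P_word w n (d - k))
      has_sum \<mu> (word_nat w n) d) {..1}"
    by (rule has_sum_cong_neutral) (auto simp: \<mu>_1[simplified])
  finally show "((\<lambda>k::int. (1/2) powi (2 - k) * P_word w n (d - k))
      has_sum \<mu> (word_nat w n) d) {..1}" .
qed

end
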